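(* Consider a Pontryagin extremal to the Reinhardt problem that contains a singular subarc along which the Hamiltonian is independent of the control (i.e. an open time interval during which $v\mapsto\mathcal H(v)$ is constant on $U_T$). Then during that time interval, the extremal remains in the singular locus $\mathcal S_{sing}$. Moreover, the unique solution to the system of state and costate equations on that interval is a multi-curve of circular arcs, up to affine transformation: $g(t)=g_0\exp(Jt)$ for some $g_0\in\mathrm{SL}_2(\mathbb R)$. Conversely, the lifted trajectory attached to a multi-curve of circular arcs is a Pontryagin extremal singular subarc.
   Context: Notation: $\langle X,Y\rangle=\mathrm{trace}(XY)$, $[X,Y]=XY-YX$ on $\mathfrak{sl}_2(\mathbb R)$; $J=\begin{pmatrix}0&-1\\ 1&0\end{pmatrix}$; $U_T=\{(u_0,u_1,u_2):u_i\ge0,\sum u_i=1\}$; $Z_u=\begin{pmatrix}\frac{u_1-u_2}{\sqrt3}&\frac{u_0-2u_1-2u_2}{3}\\ u_0&\frac{u_2-u_1}{\sqrt3}\end{pmatrix}$; $\Phi(x+iy)=\begin{pmatrix}x/y&-(x^2+y^2)/y\\ 1/y&-x/y\end{pmatrix}$; $\mathfrak h^\star=\{x+iy:y>0,|x|<1/\sqrt3,x^2+y^2>1/3\}$. A Pontryagin extremal (on an interval) of the Reinhardt problem consists of a measurable control $u$ with values in $U_T$, absolutely continuous $g$ in $\mathrm{SL}_2(\mathbb R)$, $X=\Phi(z)$ with $z$ in $\mathfrak h^\star$, $\Lambda_1,\Lambda_R$ in $\mathfrak{sl}_2(\mathbb R)$ with $\langle\Lambda_R,X\rangle=0$, and a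 constant $\lambda_{cost}\le0$, with $(\lambda_{cost},\Lambda_1,\Lambda_R)$ nowhere zero, such that, with $P=Z_u/\langle Z_u,X\rangle$, $$g'=gX,\quad X'=[P,X],\quad\Lambda_1'=[\Lambda_1,X],\quad\Lambda_R'=[P,\Lambda_R]-\langle\Lambda_R,P\rangle[P,X]+[-\Lambda_1+\tfrac32\lambda_{cost}J,X],$$ and for almost every $t$ the Hamiltonian $\mathcal H(v)=\langle\Lambda_1-\frac32\lambda_{cost}J,X\rangle-\frac{\langle\Lambda_R,Z_v\rangle}{\langle X,Z_v\rangle}$ is maximized over $v\in U_T$ at $v=u(t)$, with maximal value $0$. A singular subarc is the restriction of an extremal to an open time interval on which the maximization fails to uniquely determine the control. Singular locus: $\mathcal S_{sing}=\{(g,\Lambda_1,X,\Lambda_R)=(g_0,\frac32\lambda_{cost}J,J,0):g_0\in\mathrm{SL}_2(\mathbb R),\lambda_{cost}\ne0\}$. A trajectory determines the six curves $\sigma_j(t)=g(t)\mathbf s_j^*$, $\mathbf s_j^*=(\cos(\pi j/3),\sin(\pi j/3))$; a multi-curve of circular arcs (up to affine transformation) is the one given by $g(t)=g_0\exp(Jt)$, $X=J$. The lifted trajectory attached to it is $X=J$, control $(1/3,1/3,1/3)$, $\Lambda_1=\frac32\lambda_{cost}J$, $\Lambda_R=0$, with $\lambda_{cost}<0$ constant. *)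

theory Defs
  imports "HOL-Analysis.Analysis"
begin

section \<open>Matrices\<close>

definition mat2 :: "real \<Rightarrow> real \<Rightarrow> real \<Rightarrow> real \<Rightarrow> real^2^2" where
  "mat2 a b c d = vector [vector [a, b], vector [c, d]]"

definition SL2 :: "(real^2^2) set" where
  "SL2 = {A. det A = 1}"

definition sl2 :: "(real^2^2) set" where
  "sl2 = {A. trace A = 0}"

definition tr_form :: "real^2^2 \<Rightarrow> real^2^2 \<Rightarrow> real" where
  "tr_form A B = trace (A ** B)"

definition bracket :: "real^2^2 \<Rightarrow> real^2^2 \<Rightarrow> real^2^2" where
  "bracket A B = A ** B - B ** A"

definition J :: "real^2^2" where
  "J = mat2 0 (-1) 1 0"

text \<open>The multiplication of type class \<open>times\<close> on vectors is componentwise,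
  so matrix powers are iterates of \<open>**\<close>.\<close>

definition mat_exp :: "real^'n^'n \<Rightarrow> real^'n^'n" where
  "mat_exp A = (\<Sum>k. (((**) A) ^^ k) (mat 1) /\<^sub>R fact k)"

section \<open>Absolutely continuous curves\<close>

text \<open>The epsilon-delta definition: the members of \<open>D\<close> are finitely many
  non-overlapping compact intervals \<open>[Inf K, Sup K]\<close>.\<close>

definition abs_continuous_on :: "real set \<Rightarrow> (real \<Rightarrow> 'a::real_normed_vector) \<Rightarrow> bool" where
  "abs_continuous_on S f \<longleftrightarrow>
     (\<forall>\<epsilon>>0. \<exists>\<delta>>0. \<forall>D. D division_of \<Union>D \<and> \<Union>D \<subseteq> S \<and> (\<Sum>K\<in>D. Sup K - Inf K) < \<delta>
        \<longrightarrow> (\<Sum>K\<in>D. norm (f (Sup K) - f (Inf K))) < \<epsilon>)"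

text \<open>The regularity of Caratheodory solutions on an arbitrary interval:
  absolute continuity on compact subintervals.\<close>

definition loc_abs_continuous_on :: "real set \<Rightarrow> (real \<Rightarrow> 'a::real_normed_vector) \<Rightarrow> bool" where
  "loc_abs_continuous_on I f \<longleftrightarrow> (\<forall>a b. {a..b} \<subseteq> I \<longrightarrow> abs_continuous_on {a..b} f)"

section \<open>The Reinhardt control problem\<close>

type_synonym control = "real \<times> real \<times> real"

definition U_T :: "control set" where
  "U_T = {(u0, u1, u2). 0 \<le> u0 \<and> 0 \<le> u1 \<and> 0 \<le> u2 \<and> u0 + u1 + u2 = 1}"

definition Z :: "control \<Rightarrow> real^2^2" where
  "Z u = (case u of (u0, u1, u2) \<Rightarrow>
     mat2 ((u1 - u2) / sqrt 3) ((u0 - 2 * u1 - 2 * u2) / 3)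
          u0                   ((u2 - u1) / sqrt 3))"

definition \<Phi> :: "complex \<Rightarrow> real^2^2" where
  "\<Phi> z = (let x = Re z; y = Im z in
     mat2 (x / y) (- (x^2 + y^2) / y)
          (1 / y) (- x / y))"

definition h_star :: "complex set" where
  "h_star = {z. Im z > 0 \<and> \<bar>Re z\<bar> < 1 / sqrt 3 \<and> (Re z)^2 + (Im z)^2 > 1 / 3}"

text \<open>The quotients below are genuine: \<open>tr_form (Z u) X < 0\<close> whenever
  \<open>u \<in> U_T\<close> and \<open>X \<in> \<Phi> ` h_star\<close>; the inequalities defining \<open>h_star\<close> express this
  at the three vertices of \<open>U_T\<close>.\<close>

definition P :: "control \<Rightarrow> real^2^2 \<Rightarrow> real^2^2" where
  "P u X = Z u /\<^sub>R tr_form (Z u) X"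

definition hamiltonian ::
    "real \<Rightarrow> real^2^2 \<Rightarrow> real^2^2 \<Rightarrow> real^2^2 \<Rightarrow> control \<Rightarrow> real" where
  "hamiltonian lcost X \<Lambda>1 \<Lambda>R v =
     tr_form (\<Lambda>1 - (3/2 * lcost) *\<^sub>R J) X - tr_form \<Lambda>R (Z v) / tr_form X (Z v)"

definition pontryagin_extremal ::
    "real set \<Rightarrow> (real \<Rightarrow> control) \<Rightarrow> (real \<Rightarrow> real^2^2) \<Rightarrow> (real \<Rightarrow> real^2^2) \<Rightarrow>
     (real \<Rightarrow> real^2^2) \<Rightarrow> (real \<Rightarrow> real^2^2) \<Rightarrow> real \<Rightarrow> bool" where
  "pontryagin_extremal I u g X \<Lambda>1 \<Lambda>R lcost \<longleftrightarrow>
     is_interval I \<and> interior I \<noteq> {} \<and>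
     u \<in> borel_measurable (lebesgue_on I) \<and> (\<forall>t\<in>I. u t \<in> U_T) \<and>
     loc_abs_continuous_on I g \<and> (\<forall>t\<in>I. g t \<in> SL2) \<and>
     loc_abs_continuous_on I X \<and> (\<forall>t\<in>I. X t \<in> \<Phi> ` h_star) \<and>
     loc_abs_continuous_on I \<Lambda>1 \<and> (\<forall>t\<in>I. \<Lambda>1 t \<in> sl2) \<and>
     loc_abs_continuous_on I \<Lambda>R \<and> (\<forall>t\<in>I. \<Lambda>R t \<in> sl2 \<and> tr_form (\<Lambda>R t) (X t) = 0) \<and>
     lcost \<le> 0 \<and> (\<forall>t\<in>I. (lcost, \<Lambda>1 t, \<Lambda>R t) \<noteq> (0, 0, 0)) \<and>
     (AE t in lebesgue_on I.
        (g has_vector_derivative g t ** X t) (at t within I) \<and>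
        (X has_vector_derivative bracket (P (u t) (X t)) (X t)) (at t within I) \<and>
        (\<Lambda>1 has_vector_derivative bracket (\<Lambda>1 t) (X t)) (at t within I) \<and>
        (\<Lambda>R has_vector_derivative
             bracket (P (u t) (X t)) (\<Lambda>R t)
             - tr_form (\<Lambda>R t) (P (u t) (X t)) *\<^sub>R bracket (P (u t) (X t)) (X t)
             + bracket (- \<Lambda>1 t + (3/2 * lcost) *\<^sub>R J) (X t)) (at t within I)) \<and>
     (AE t in lebesgue_on I.
        is_arg_max (hamiltonian lcost (X t) (\<Lambda>1 t) (\<Lambda>R t)) (\<lambda>v. v \<in> U_T) (u t) \<and>
        hamiltonian lcost (X t) (\<Lambda>1 t) (\<Lambda>R t) (u t) = 0)"

text \<open>The restriction to \<open>T\<close> of an extremal on \<open>I\<close> is a singular subarc. A maximizer always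
  exists, so the last condition says that there are several.\<close>

definition singular_subarc ::
    "real set \<Rightarrow> real set \<Rightarrow> (real \<Rightarrow> control) \<Rightarrow> (real \<Rightarrow> real^2^2) \<Rightarrow> (real \<Rightarrow> real^2^2) \<Rightarrow>
     (real \<Rightarrow> real^2^2) \<Rightarrow> (real \<Rightarrow> real^2^2) \<Rightarrow> real \<Rightarrow> bool" where
  "singular_subarc I T u g X \<Lambda>1 \<Lambda>R lcost \<longleftrightarrow>
     pontryagin_extremal I u g X \<Lambda>1 \<Lambda>R lcost \<and>
     is_interval T \<and> open T \<and> T \<noteq> {} \<and> T \<subseteq> I \<and>
     (\<forall>t\<in>T. \<not> (\<exists>!v. is_arg_max (hamiltonian lcost (X t) (\<Lambda>1 t) (\<Lambda>R t)) (\<lambda>v. v \<in> U_T) v))"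

text \<open>Points are listed as \<open>(g, \<Lambda>1, X, \<Lambda>R)\<close>; \<open>lcost\<close> is the cost multiplier of the extremal.\<close>

definition S_sing :: "real \<Rightarrow> ((real^2^2) \<times> (real^2^2) \<times> (real^2^2) \<times> (real^2^2)) set" where
  "S_sing lcost = {(g0, (3/2 * lcost) *\<^sub>R J, J, 0) | g0. g0 \<in> SL2 \<and> lcost \<noteq> 0}"

section \<open>Multi-curves\<close>

definition s_star :: "nat \<Rightarrow> real^2" where
  "s_star j = vector [cos (pi * real j / 3), sin (pi * real j / 3)]"

definition multi_curve :: "(real \<Rightarrow> real^2^2) \<Rightarrow> nat \<Rightarrow> real \<Rightarrow> real^2" where
  "multi_curve g j t = g t *v s_star j"

text \<open>The frame of the multi-curve of circular arcs, up to the affine transformation \<open>g0\<close>.\<close>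

definition circular_frame :: "real^2^2 \<Rightarrow> real \<Rightarrow> real^2^2" where
  "circular_frame g0 t = g0 ** mat_exp (t *\<^sub>R J)"

end

theory Submission
  imports Defs
begin

text \<open>A Hamiltonian that does not depend on the control forces \<open>\<Lambda>R = 0\<close>, because the matrices
  \<open>Z v\<close> span \<open>sl2\<close>. The remaining equations then collapse one after another. The equation
  for \<open>\<Lambda>R\<close> says that \<open>\<Lambda>1 - 3/2 lcost J\<close> commutes with \<open>X\<close>, and the vanishing of the
  Hamiltonian says that it is orthogonal to \<open>X\<close>, so it is zero. Nontriviality gives
  \<open>lcost \<noteq> 0\<close>, so the equation for \<open>\<Lambda>1\<close> says that \<open>X\<close> commutes with \<open>J\<close>, hence \<open>X = J\<close>.
  The equation for \<open>X\<close> then singles out the centre of \<open>U_T\<close>. Each conclusion holds almost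
  everywhere first, and everywhere by continuity. Finally \<open>g' = g J\<close> almost everywhere, and the
  fundamental theorem of calculus for absolutely continuous curves shows that \<open>g\<close> is a classical
  solution.\<close>

section \<open>Absolutely continuous curves\<close>

lemma abs_continuous_on_subset:
  assumes f: "abs_continuous_on S f" and "T \<subseteq> S"
  shows "abs_continuous_on T f"
  unfolding abs_continuous_on_def
proof (intro allI impI)
  fix e :: real assume "e > 0"
  then obtain d where "d > 0" and
    d: "\<And>D. \<lbrakk>D division_of \<Union>D; \<Union>D \<subseteq> S; (\<Sum>K\<in>D. Sup K - Inf K) < d\<rbrakk>
        \<Longrightarrow> (\<Sum>K\<in>D. norm (f (Sup K) - f (Inf K))) < e"
    using f[unfolded abs_continuous_on_def, rule_format, of e] by auto
  show "\<exists>d>0. \<forall>D. D division_of \<Union>D \<and> \<Union>D \<subseteq> T \<and> (\<Sum>K\<in>D. Sup K - Inf K) < d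
      \<longrightarrow> (\<Sum>K\<in>D. norm (f (Sup K) - f (Inf K))) < e"
    by (intro exI[of _ d] conjI allI impI \<open>d > 0\<close>, elim conjE, rule d)
      (assumption | erule order_trans[OF _ \<open>T \<subseteq> S\<close>])+
qed

text \<open>Continuity is the case of a division with a single member, the interval between the two
  points.\<close>

lemma abs_continuous_on_imp_continuous_on:
  fixes f :: "real \<Rightarrow> 'a::real_normed_vector"
  assumes "abs_continuous_on {a..b} f"
  shows "continuous_on {a..b} f"
  unfolding continuous_on_iff
proof (intro ballI allI impI)
  fix x e :: real
  assume x: "x \<in> {a..b}" and "e > 0"
  then obtain d where "d > 0" and
    d: "\<And>D. \<lbrakk>D division_of \<Union>D; \<Union>D \<subseteq> {a..b}; (\<Sum>K\<in>D. Sup K - Inf K) < d\<rbrakk>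
        \<Longrightarrow> (\<Sum>K\<in>D. norm (f (Sup K) - f (Inf K))) < e"
    using assms[unfolded abs_continuous_on_def, rule_format, of e] by auto
  have *: "norm (f t - f s) < e" if "s \<in> {a..b}" "t \<in> {a..b}" "s \<le> t" "t - s < d" for s t
  proof -
    have "{{s..t}} division_of \<Union>{{s..t}}"
      using division_of_self[of s t] that(3) by (simp add: box_real)
    moreover have "\<Union>{{s..t}} \<subseteq> {a..b}"
      using that(1,2) by simp
    ultimately show ?thesis
      using d[of "{{s..t}}"] that(3,4) by simp
  qed
  have "dist (f y) (f x) < e" if "y \<in> {a..b}" "dist y x < d" for y
  proof (cases "x \<le> y")
    case True
    then show ?thesis using *[OF x that(1)] that(2) by (simp add: dist_norm)
  next
    case False
    then show ?thesis using *[OF that(1) x] that(2) by (simp add: dist_norm norm_minus_commute)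
  qed
  with \<open>d > 0\<close> show "\<exists>d>0. \<forall>x'\<in>{a..b}. dist x' x < d \<longrightarrow> dist (f x') (f x) < e"
    by blast
qed

text \<open>Every point of the open set \<open>T\<close> is interior to a compact interval inside
  \<open>I\<close>, and absolute continuity is available there.\<close>

lemma loc_abs_continuous_on_imp_continuous_on:
  fixes f :: "real \<Rightarrow> 'a::real_normed_vector"
  assumes f: "loc_abs_continuous_on I f" and "open T" "T \<subseteq> I"
  shows "continuous_on T f"
proof (rule continuous_at_imp_continuous_on, intro ballI)
  fix t assume "t \<in> T"
  then obtain e where e: "e > 0" "cball t e \<subseteq> T"
    using \<open>open T\<close> open_contains_cball by blast
  have "{t - e..t + e} \<subseteq> I"
    using e \<open>T \<subseteq> I\<close> by (auto simp: cball_eq_atLeastAtMost)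
  then have "continuous_on {t - e..t + e} f"
    using f unfolding loc_abs_continuous_on_def by (blast intro: abs_continuous_on_imp_continuous_on)
  moreover have "t \<in> interior {t - e..t + e}"
    using e by simp
  ultimately show "isCont f t"
    by (rule continuous_on_interior)
qed

lemma lipschitz_on_imp_abs_continuous_on:
  fixes f :: "real \<Rightarrow> 'a::real_normed_vector"
  assumes "C-lipschitz_on S f"
  shows "abs_continuous_on S f"
  unfolding abs_continuous_on_def
proof (intro allI impI)
  fix e :: real assume "e > 0"
  have "C \<ge> 0" using assms by (rule lipschitz_on_nonneg)
  show "\<exists>\<delta>>0. \<forall>D. D division_of \<Union> D \<and> \<Union> D \<subseteq> S \<and> (\<Sum>K\<in>D. Sup K - Inf K) < \<delta>
      \<longrightarrow> (\<Sum>K\<in>D. norm (f (Sup K) - f (Inf K))) < e"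
  \<comment> \<open>Dividing by \<open>C + 1\<close> rather than \<open>C\<close> also covers
    \<open>C = 0\<close>.\<close>
  proof (intro exI[of _ "e / (C + 1)"] conjI allI impI; (elim conjE)?)
    show "e / (C + 1) > 0" using \<open>e > 0\<close> \<open>C \<ge> 0\<close> by simp
  next
    fix D assume D: "D division_of \<Union> D" "\<Union> D \<subseteq> S" "(\<Sum>K\<in>D. Sup K - Inf K) < e / (C + 1)"
    have K: "norm (f (Sup K) - f (Inf K)) \<le> (C + 1) * (Sup K - Inf K)" if KD: "K \<in> D" for K
    proof -
      obtain s t where st: "K = {s..t}" "s \<le> t"
        using division_ofD(3,4)[OF D(1) KD] by (auto simp: box_real)
      have "{s..t} \<subseteq> S" using D(2) KD st(1) by blast
      then have "s \<in> S" "t \<in> S" using st(2) by auto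
      then have "norm (f t - f s) \<le> C * (t - s)"
        using lipschitz_onD[OF assms, of t s] st by (simp add: dist_norm)
      then show ?thesis using st by (simp add: algebra_simps)
    qed
    have "(\<Sum>K\<in>D. norm (f (Sup K) - f (Inf K))) \<le> (C + 1) * (\<Sum>K\<in>D. Sup K - Inf K)"
      unfolding sum_distrib_left by (rule sum_mono) (rule K)
    also have "\<dots> < e"
      using D(3) \<open>C \<ge> 0\<close> by (simp add: pos_less_divide_eq mult.commute)
    finally show "(\<Sum>K\<in>D. norm (f (Sup K) - f (Inf K))) < e" .
  qed
qed

text \<open>For a tag outside \<open>N\<close> the gauge comes from differentiability. For a tag in \<open>N\<close> it is an
  open set of small measure around \<open>N\<close>, so that absolute continuity bounds the total increment
  over the tagged intervals there.\<close>

theorem fundamental_theorem_of_calculus_abs_continuous: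
  fixes f :: "real \<Rightarrow> 'a::banach"
  assumes "a \<le> b" and f: "abs_continuous_on {a..b} f" and N: "negligible N"
    and f': "\<And>x. x \<in> {a..b} - N \<Longrightarrow> (f has_vector_derivative f' x) (at x within {a..b})"
  shows "(f' has_integral (f b - f a)) {a..b}"
proof -
  \<comment> \<open>With the integrand set to zero on \<open>N\<close>, a tag in \<open>N\<close>
    contributes only the increment of \<open>f\<close> over its interval.\<close>
  define F where "F = (\<lambda>x. if x \<in> N then 0 else f' x)"
  have "(F has_integral (f b - f a)) {a..b}"
    unfolding has_integral[where a=a and b=b, unfolded box_real]
  proof (intro allI impI)
    fix e :: real assume "e > 0"
    \<comment> \<open>The summand 1 keeps the divisor positive when \<open>a = b\<close> and makes
      \<open>c * (b - a)\<close> strictly less than \<open>e / 2\<close>. The other half of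
      \<open>e\<close> is reserved for the tags in \<open>N\<close>.\<close>
    define c where "c = e / (2 * (b - a + 1))"
    have "c > 0" using \<open>e > 0\<close> \<open>a \<le> b\<close> by (simp add: c_def)
    have cba: "c * (b - a) < e / 2"
      using \<open>e > 0\<close> \<open>a \<le> b\<close> by (simp add: c_def field_simps)
    have "\<forall>x. \<exists>d>0. x \<in> {a..b} - N \<longrightarrow>
           (\<forall>y\<in>{a..b}. norm (y-x) < d \<longrightarrow> norm (f y - f x - (y-x) *\<^sub>R f' x) \<le> c * norm (y-x))"
      using f'[unfolded has_vector_derivative_def has_derivative_within_alt] \<open>c > 0\<close>
      by (metis zero_less_one)
    from choice[OF this] obtain r where r: "\<And>x. 0 < r x"
       "\<And>x y. \<lbrakk>x \<in> {a..b} - N; y \<in> {a..b}; norm (y-x) < r x\<rbrakk>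
                        \<Longrightarrow> norm (f y - f x - (y-x) *\<^sub>R f' x) \<le> c * norm (y-x)"
      by blast
    obtain d where "d > 0" and
      d: "\<And>D. \<lbrakk>D division_of \<Union>D; \<Union>D \<subseteq> {a..b}; (\<Sum>K\<in>D. Sup K - Inf K) < d\<rbrakk>
          \<Longrightarrow> (\<Sum>K\<in>D. norm (f (Sup K) - f (Inf K))) < e / 2"
      using f[unfolded abs_continuous_on_def, rule_format, of "e / 2"] \<open>e > 0\<close> by auto
    have Nl: "N \<in> null_sets lebesgue" using N by (simp add: negligible_iff_null_sets)
    then obtain V where V: "open V" "N \<subseteq> V" "V - N \<in> lmeasurable" "emeasure lebesgue (V - N) < ennreal d"
      using sets_lebesgue_outer_open[of N d] \<open>d > 0\<close> by auto
    have VU: "V = (V - N) \<union> N" using V by auto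
    have "V \<in> lmeasurable"
      by (subst VU) (intro fmeasurable.Un V(3) negligible_imp_measurable N)
    have "emeasure lebesgue V < ennreal d"
      using V(4) VU emeasure_Un_null_set[of "V - N" lebesgue N] V(3) Nl by auto
    then have Vd: "measure lebesgue V < d"
      using \<open>V \<in> lmeasurable\<close> \<open>d > 0\<close> by (simp add: emeasure_eq_measure2 ennreal_less_iff)
    define \<gamma> where "\<gamma> = (\<lambda>x. if x \<in> N then V else ball x (r x))"
    have "gauge \<gamma>"
      using r(1) V by (auto simp: gauge_def \<gamma>_def)
    have small: "norm ((\<Sum>(x,K)\<in>p. measure lborel K *\<^sub>R F x) - (f b - f a)) < e"
      if p: "p tagged_division_of {a..b}" and fine: "\<gamma> fine p" for p
    proof -
      have "finite p" using p by blast
      define q where "q = {(x,K) \<in> p. x \<in> N}"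
      have "q \<subseteq> p" "finite q" using \<open>finite p\<close> by (auto simp: q_def intro: finite_subset)
      have bds: "\<exists>u v. K = {u..v} \<and> u \<le> v \<and> a \<le> u \<and> v \<le> b \<and> x \<in> {u..v}" if "(x,K) \<in> p" for x K
        using tagged_division_ofD(2,3,4)[OF p that] by (auto simp: box_real)
      have qt: "q tagged_partial_division_of {a..b}"
        using p \<open>q \<subseteq> p\<close> by (meson tagged_division_of_def tagged_partial_division_subset)
      then have qu: "q tagged_division_of \<Union>(snd ` q)"
        by (rule tagged_partial_division_of_Union_self)
      have qd: "snd ` q division_of \<Union>(snd ` q)"
        using qt by (rule partial_division_of_tagged_division)
      have qsub: "\<Union>(snd ` q) \<subseteq> {a..b}"
        using tagged_partial_division_ofD(3)[OF qt] by (intro Union_least) (metis imageE prod.collapse)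
      \<comment> \<open>Fineness keeps the intervals tagged in \<open>N\<close> inside
        \<open>V\<close>, so their total length is below \<open>d\<close> and absolute continuity
        applies to them.\<close>
      have "(\<Sum>K\<in>snd ` q. Sup K - Inf K) = (\<Sum>K\<in>snd ` q. measure lebesgue K)"
      proof (rule sum.cong[OF refl])
        fix K assume "K \<in> snd ` q"
        then obtain x where "(x, K) \<in> p" using \<open>q \<subseteq> p\<close> by auto
        from bds[OF this] show "Sup K - Inf K = measure lebesgue K" by auto
      qed
      also have "\<dots> = measure lebesgue (\<Union>(snd ` q))"
        using qd by (rule content_division)
      also have "\<dots> \<le> measure lebesgue V"
      proof (rule measure_mono_fmeasurable)
        have "K \<subseteq> V" if "(x, K) \<in> q" for x K
          using fineD[OF fine, of x K] that by (auto simp: q_def \<gamma>_def)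
        then show "\<Union> (snd ` q) \<subseteq> V" by fastforce
        show "\<Union> (snd ` q) \<in> sets lebesgue"
          using qd lmeasurable_division by blast
      qed fact
      also note Vd
      finally have q: "(\<Sum>K\<in>snd ` q. norm (f (Sup K) - f (Inf K))) < e / 2"
        by (intro d qd qsub)
      have ne: "K \<noteq> {}" if "(x, K) \<in> q" for x K
        using tagged_partial_division_ofD(2)[OF qt that] by auto
      \<comment> \<open>Absolute continuity bounds a sum over intervals, while the Riemann sum runs
        over tagged pairs. Distinct pairs can share an interval only if its interior is empty, and
        the increment over it is then zero. The value at the empty set is fixed as 0 because
        \<open>sum.over_tagged_division_lemma\<close> asks for vanishing there too.\<close>
      define D where "D K = (if K = {} then 0 else norm (f (Sup K) - f (Inf K)))" for K
      have "(\<Sum>(x,K)\<in>q. norm (f (Sup K) - f (Inf K))) = (\<Sum>(x,K)\<in>q. D K)"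
        using ne by (intro sum.cong refl) (auto simp: D_def)
      also have "\<dots> = (\<Sum>K\<in>snd ` q. D K)"
      proof (rule sum.over_tagged_division_lemma[OF qu])
        show "D (cbox u v) = 0" if "box u v = {}" for u v :: real
          using that by (cases "u = v") (auto simp: box_real D_def)
      qed
      also have "\<dots> = (\<Sum>K\<in>snd ` q. norm (f (Sup K) - f (Inf K)))"
        using ne by (intro sum.cong refl) (auto simp: D_def)
      also note q
      finally have q': "(\<Sum>(x,K)\<in>q. norm (f (Sup K) - f (Inf K))) < e / 2" .
      have le: "norm (measure lborel K *\<^sub>R F x - (f (Sup K) - f (Inf K)))
           \<le> (if x \<in> N then norm (f (Sup K) - f (Inf K)) else 0) + c * (Sup K - Inf K)"
        if xK: "(x,K) \<in> p" for x K
      proof -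
        obtain u v where uv: "K = {u..v}" "u \<le> v" "a \<le> u" "v \<le> b" "x \<in> {u..v}"
          using bds[OF xK] by blast
        show ?thesis
        proof (cases "x \<in> N")
          case True
          then show ?thesis using uv \<open>c > 0\<close> by (simp add: F_def norm_minus_commute[of "f u"])
        next
          case False
          then have "K \<subseteq> ball x (r x)" using fineD[OF fine xK] by (auto simp: \<gamma>_def)
          moreover have "u \<in> K" "v \<in> K" using uv by auto
          ultimately have "u \<in> ball x (r x)" "v \<in> ball x (r x)" by blast+
          then have le: "norm (f u - f x - (u-x) *\<^sub>R f' x) \<le> c * norm (u-x)"
            "norm (f v - f x - (v-x) *\<^sub>R f' x) \<le> c * norm (v-x)"
            using r(2)[of x u] r(2)[of x v] False uv by (auto simp: dist_real_def)
          \<comment> \<open>Both endpoints are compared with the tag; since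
            \<open>u \<le> x \<le> v\<close>, the two errors add up to exactly
            \<open>c * (v - u)\<close>.\<close>
          have eq: "(v - u) *\<^sub>R f' x - (f v - f u)
              = (f u - f x - (u - x) *\<^sub>R f' x) - (f v - f x - (v - x) *\<^sub>R f' x)"
            by (simp add: algebra_simps)
          have "norm ((v - u) *\<^sub>R f' x - (f v - f u)) \<le> c * norm (u-x) + c * norm (v-x)"
            unfolding eq by (rule order_trans[OF norm_triangle_ineq4 add_mono[OF le]])
          also have "\<dots> = c * (v - u)" using uv by (simp add: algebra_simps)
          finally show ?thesis using False uv by (simp add: F_def)
        qed
      qed
      \<comment> \<open>The difference \<open>f b - f a\<close> telescopes over the tagged division,
        so the error can be estimated interval by interval.\<close>
      have "(\<Sum>(x,K)\<in>p. measure lborel K *\<^sub>R F x) - (f b - f a)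
          = (\<Sum>(x,K)\<in>p. measure lborel K *\<^sub>R F x - (f (Sup K) - f (Inf K)))"
        unfolding additive_tagged_division_1[OF \<open>a \<le> b\<close> p, of f, symmetric]
        by (simp add: sum_subtractf split_def)
      also have "norm \<dots> \<le> (\<Sum>(x,K)\<in>p. (if x \<in> N then norm (f (Sup K) - f (Inf K)) else 0)
          + c * (Sup K - Inf K))"
        by (rule sum_norm_le) (use le in auto)
      also have "\<dots> = (\<Sum>(x,K)\<in>p. if x \<in> N then norm (f (Sup K) - f (Inf K)) else 0)
          + c * (\<Sum>(x,K)\<in>p. Sup K - Inf K)"
        by (simp add: sum.distrib sum_distrib_left split_def)
      also have "(\<Sum>(x,K)\<in>p. if x \<in> N then norm (f (Sup K) - f (Inf K)) else 0)
          = (\<Sum>(x,K)\<in>q. norm (f (Sup K) - f (Inf K)))"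
        by (rule sum.mono_neutral_cong_right) (use \<open>finite p\<close> in \<open>auto simp: q_def split: if_splits\<close>)
      also have "(\<Sum>(x,K)\<in>p. Sup K - Inf K) = b - a"
        using additive_tagged_division_1[OF \<open>a \<le> b\<close> p, of "\<lambda>x. x"] by simp
      finally show ?thesis using q' cba by linarith
    qed
    show "\<exists>\<gamma>. gauge \<gamma> \<and> (\<forall>p. p tagged_division_of {a..b} \<and> \<gamma> fine p \<longrightarrow>
        norm ((\<Sum>(x,K)\<in>p. measure lborel K *\<^sub>R F x) - (f b - f a)) < e)"
      using small by (intro exI[of _ \<gamma>] conjI allI impI \<open>gauge \<gamma>\<close>) (elim conjE)
  qed
  then show ?thesis
    by (rule has_integral_spike[OF N, rotated]) (simp add: F_def)
qed

text \<open>The curve is the indefinite integral of \<open>f'\<close>; as \<open>f'\<close> is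
  continuous, the classical theorem differentiates this integral at every point, including those in
  \<open>N\<close>.\<close>

corollary abs_continuous_on_has_vector_derivative:
  fixes f :: "real \<Rightarrow> 'a::banach"
  assumes f: "abs_continuous_on {a..b} f" and N: "negligible N"
    and f': "\<And>x. x \<in> {a..b} - N \<Longrightarrow> (f has_vector_derivative f' x) (at x within {a..b})"
    and cont: "continuous_on {a..b} f'" and x: "x \<in> {a..b}"
  shows "(f has_vector_derivative f' x) (at x within {a..b})"
proof -
  have eq: "f y = f a + integral {a..y} f'" if y: "y \<in> {a..b}" for y
  proof -
    have sub: "{a..y} \<subseteq> {a..b}" using y by auto
    have "abs_continuous_on {a..y} f"
      using f sub by (rule abs_continuous_on_subset)
    then have "(f' has_integral (f y - f a)) {a..y}"
      using y sub by (intro fundamental_theorem_of_calculus_abs_continuous[OF _ _ N])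
        (auto intro: has_vector_derivative_within_subset[OF f'])
    then show ?thesis by (simp add: integral_unique)
  qed
  have "((\<lambda>y. f a + integral {a..y} f') has_vector_derivative 0 + f' x) (at x within {a..b})"
    by (intro has_vector_derivative_add has_vector_derivative_const integral_has_vector_derivative cont x)
  then have "((\<lambda>y. f a + integral {a..y} f') has_vector_derivative f' x) (at x within {a..b})"
    by simp
  with x eq show ?thesis
    by (rule has_vector_derivative_transform)
qed

text \<open>The part of \<open>T\<close> where \<open>f\<close> differs from \<open>c\<close> is
  open and contained in \<open>N\<close>, and a nonempty open set is not negligible.\<close>

lemma continuous_on_eq_outside_negligible:
  fixes f :: "real \<Rightarrow> 'a::t1_space"
  assumes "open T" "continuous_on T f" "negligible N"
    and "\<And>t. t \<in> T - N \<Longrightarrow> f t = c" and "t \<in> T"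
  shows "f t = c"
proof -
  have "open (T \<inter> f -` (- {c}))"
    using assms(1,2) by (intro continuous_open_preimage) auto
  moreover have "negligible (T \<inter> f -` (- {c}))"
    by (rule negligible_subset[OF assms(3)]) (use assms(4) in auto)
  ultimately have "T \<inter> f -` (- {c}) = {}"
    using open_not_negligible by blast
  with \<open>t \<in> T\<close> show ?thesis by blast
qed

section \<open>Almost-everywhere statements and exceptional null sets\<close>

lemma AE_lebesgue_on_negligible:
  assumes "S \<in> sets lebesgue" "AE t in lebesgue_on S. Q t"
  obtains N where "negligible N" "\<And>t. t \<in> S - N \<Longrightarrow> Q t"
proof -
  have "AE t in lebesgue. t \<in> S \<longrightarrow> Q t"
    using assms by (simp add: AE_restrict_space_iff)
  then obtain N where "N \<in> null_sets lebesgue" "{t. \<not> (t \<in> S \<longrightarrow> Q t)} \<subseteq> N"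
    by (auto simp: eventually_ae_filter)
  then show thesis using that[of N] by (auto simp: negligible_iff_null_sets)
qed

lemma AE_lebesgue_onI:
  assumes "S \<in> sets lebesgue" "negligible N" "\<And>t. t \<in> S - N \<Longrightarrow> Q t"
  shows "AE t in lebesgue_on S. Q t"
proof -
  have "AE t in lebesgue. t \<in> S \<longrightarrow> Q t"
    by (rule AE_I'[of N]) (use assms in \<open>auto simp: negligible_iff_null_sets\<close>)
  with assms(1) show ?thesis by (simp add: AE_restrict_space_iff)
qed

section \<open>Two by two matrices\<close>

lemma mat2_nth [simp]:
  "mat2 a b c d $ 1 $ 1 = a" "mat2 a b c d $ 1 $ 2 = b"
  "mat2 a b c d $ 2 $ 1 = c" "mat2 a b c d $ 2 $ 2 = d"
  by (simp_all add: mat2_def)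

lemma mat2_cases: obtains a b c d where "A = mat2 a b c d"
  by (rule that[of "A$1$1" "A$1$2" "A$2$1" "A$2$2"]) (simp add: vec_eq_iff forall_2)

lemma mat2_simps:
  "mat2 a b c d = mat2 a' b' c' d' \<longleftrightarrow> a = a' \<and> b = b' \<and> c = c' \<and> d = d'"
  "mat2 a b c d ** mat2 a' b' c' d'
     = mat2 (a * a' + b * c') (a * b' + b * d') (c * a' + d * c') (c * b' + d * d')"
  "mat2 a b c d + mat2 a' b' c' d' = mat2 (a + a') (b + b') (c + c') (d + d')"
  "mat2 a b c d - mat2 a' b' c' d' = mat2 (a - a') (b - b') (c - c') (d - d')"
  "- mat2 a b c d = mat2 (- a) (- b) (- c) (- d)"
  "r *\<^sub>R mat2 a b c d = mat2 (r * a) (r * b) (r * c) (r * d)"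
  "0 = mat2 0 0 0 0" "mat 1 = mat2 1 0 0 1"
  "trace (mat2 a b c d) = a + d"
  "det (mat2 a b c d) = a * d - b * c"
  by (auto simp: vec_eq_iff forall_2 matrix_matrix_mult_def sum_2 trace_def det_2 mat_def)

lemma mult_J_J [simp]: "A ** J ** J = - (A :: real^2^2)"
  by (cases A rule: mat2_cases) (simp add: J_def mat2_simps)

lemma bounded_linear_mult_J: "bounded_linear (\<lambda>A :: real^2^2. A ** J)"
  unfolding linear_conv_bounded_linear[symmetric]
proof (rule linearI)
  show "(A + B) ** J = A ** J + B ** J" for A B :: "real^2^2"
    by (cases A rule: mat2_cases, cases B rule: mat2_cases)
      (simp add: J_def mat2_simps algebra_simps)
  show "(r *\<^sub>R A) ** J = r *\<^sub>R (A ** J)" for A :: "real^2^2" and r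
    by (cases A rule: mat2_cases) (simp add: J_def mat2_simps algebra_simps)
qed

section \<open>The exponential of \<open>t J\<close> and circular frames\<close>

lemma mult_scaleR_J_power:
  "(((**) (t *\<^sub>R J)) ^^ n) (mat 1) /\<^sub>R fact n
     = (cos_coeff n * t ^ n) *\<^sub>R mat 1 + (sin_coeff n * t ^ n) *\<^sub>R J"
proof -
  have "(((**) (t *\<^sub>R J)) ^^ n) (mat 1)
     = (fact n * cos_coeff n * t ^ n) *\<^sub>R mat 1 + (fact n * sin_coeff n * t ^ n) *\<^sub>R J"
  \<comment> \<open>Clearing the factorial turns the recursions of \<open>cos_coeff\<close> and
    \<open>sin_coeff\<close> into the rule that multiplication by \<open>J\<close> sends 1 to
    \<open>J\<close> and \<open>J\<close> to -1.\<close>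
  proof (induction n)
    case 0
    then show ?case by simp
  next
    case (Suc n)
    then show ?case
      by (simp add: J_def mat2_simps cos_coeff_Suc sin_coeff_Suc fact_Suc)
  qed
  then show ?thesis by (simp add: scaleR_add_right field_simps)
qed

lemma mat_exp_J: "mat_exp (t *\<^sub>R J) = cos t *\<^sub>R mat 1 + sin t *\<^sub>R J"
proof -
  have "(\<lambda>n. (cos_coeff n * t ^ n) *\<^sub>R mat 1 + (sin_coeff n * t ^ n) *\<^sub>R J)
      sums (cos t *\<^sub>R mat 1 + sin t *\<^sub>R J)"
    using cos_converges[of t] sin_converges[of t]
    by (intro sums_add sums_scaleR_left) simp_all
  then show ?thesis
    unfolding mat_exp_def mult_scaleR_J_power by (rule sums_unique[symmetric])
qed

lemma circular_frame_eq: "circular_frame g0 t = cos t *\<^sub>R g0 + sin t *\<^sub>R (g0 ** J)"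
  unfolding circular_frame_def mat_exp_J
  by (cases g0 rule: mat2_cases) (simp add: J_def mat2_simps algebra_simps)

lemma circular_frame_mult_J:
  "circular_frame g0 t ** J = (- sin t) *\<^sub>R g0 + cos t *\<^sub>R (g0 ** J)"
  unfolding circular_frame_eq
  by (cases g0 rule: mat2_cases) (simp add: J_def mat2_simps algebra_simps)

lemma circular_frame_SL2: "circular_frame g0 t \<in> SL2 \<longleftrightarrow> g0 \<in> SL2"
proof (cases g0 rule: mat2_cases)
  case (1 a b c d)
  \<comment> \<open>The left side is the determinant of the frame at time \<open>t\<close>.\<close>
  have "(cos t * a + sin t * b) * (cos t * d - sin t * c)
      - (cos t * b - sin t * a) * (cos t * c + sin t * d)
    = (a * d - b * c) * ((sin t)\<^sup>2 + (cos t)\<^sup>2)"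
    unfolding power2_eq_square by algebra
  with 1 show ?thesis
    by (simp add: circular_frame_eq SL2_def J_def mat2_simps)
qed

text \<open>The exponentials of \<open>- t J\<close> and \<open>t J\<close> are mutually
  inverse.\<close>

lemma circular_frame_minus: "circular_frame (circular_frame A (- t)) t = A"
proof (cases A rule: mat2_cases)
  case (1 a b c d)
  have "x * cos t * cos t + x * sin t * sin t = x" for x
    using sin_cos_squared_add[of t] unfolding power2_eq_square by algebra
  then show ?thesis
    by (simp add: 1 circular_frame_eq J_def mat2_simps algebra_simps)
qed

lemma circular_frame_has_vector_derivative:
  "(circular_frame g0 has_vector_derivative circular_frame g0 t ** J) (at t within S)"
proof -
  have "((\<lambda>t. cos t *\<^sub>R g0 + sin t *\<^sub>R (g0 ** J)) has_vector_derivative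
      ((- sin t) *\<^sub>R g0 + cos t *\<^sub>R (g0 ** J))) (at t within S)"
    by (auto intro!: derivative_eq_intros simp flip: has_real_derivative_iff_has_vector_derivative)
  then show ?thesis
    unfolding circular_frame_mult_J by (simp add: circular_frame_eq[abs_def])
qed

text \<open>The derivative is bounded uniformly in time, so the curve is Lipschitz.\<close>

lemma loc_abs_continuous_on_circular_frame: "loc_abs_continuous_on I (circular_frame g0)"
  unfolding loc_abs_continuous_on_def
proof (intro allI impI)
  fix a b :: real
  have "(norm g0 + norm (g0 ** J))-lipschitz_on {a..b} (circular_frame g0)"
  proof (rule bounded_derivative_imp_lipschitz)
    fix t :: real assume "t \<in> {a..b}"
    let ?D = "circular_frame g0 t ** J"
    show "(circular_frame g0 has_derivative (\<lambda>s. s *\<^sub>R ?D)) (at t within {a..b})"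
      using circular_frame_has_vector_derivative by (simp add: has_vector_derivative_def)
    have "norm ?D \<le> \<bar>- sin t\<bar> * norm g0 + \<bar>cos t\<bar> * norm (g0 ** J)"
      unfolding circular_frame_mult_J by (rule norm_triangle_le) simp
    also have "\<dots> \<le> norm g0 + norm (g0 ** J)"
      by (intro add_mono mult_left_le_one_le) auto
    finally show "onorm (\<lambda>s. s *\<^sub>R ?D) \<le> norm g0 + norm (g0 ** J)"
      by (intro onorm_le) (simp add: mult.commute[of _ "\<bar>_\<bar>"] mult_left_mono)
  qed auto
  then show "abs_continuous_on {a..b} (circular_frame g0)"
    by (rule lipschitz_on_imp_abs_continuous_on)
qed

section \<open>The Hamiltonian and the state equations\<close>

text \<open>The equation is \<open>det X = 1\<close>. The inequality for \<open>q\<close> is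
  negativity of \<open>tr_form (Z v) X\<close> at the vertex \<open>(1,0,0)\<close>, and the bound
  on \<open>p\<close> is its negativity at the other two vertices.\<close>

lemma \<Phi>_h_star_cases:
  assumes "X \<in> \<Phi> ` h_star"
  obtains p q r where "X = mat2 p q r (- p)" "- p * p - q * r = 1" "r > 0"
    "q + r / 3 < 0" "\<bar>p\<bar> < r / sqrt 3"
proof -
  obtain z where z: "X = \<Phi> z" "z \<in> h_star" using assms by auto
  define x y where "x = Re z" and "y = Im z"
  have h: "y > 0" "\<bar>x\<bar> < 1 / sqrt 3" "x\<^sup>2 + y\<^sup>2 > 1 / 3"
    using z by (auto simp: h_star_def x_def y_def)
  show thesis
  proof (rule that)
    show "X = mat2 (x / y) (- (x\<^sup>2 + y\<^sup>2) / y) (1 / y) (- (x / y))"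
      by (simp add: z \<Phi>_def x_def y_def Let_def)
    show "- (x / y) * (x / y) - - (x\<^sup>2 + y\<^sup>2) / y * (1 / y) = 1" "1 / y > 0"
      using h(1) by (simp_all add: divide_simps power2_eq_square)
    have "- (x\<^sup>2 + y\<^sup>2) / y + 1 / y / 3 = (1 / 3 - (x\<^sup>2 + y\<^sup>2)) / y"
      using h(1) by (simp add: divide_simps)
    also have "\<dots> < 0"
      using h(1,3) by (simp add: divide_less_0_iff)
    finally show "- (x\<^sup>2 + y\<^sup>2) / y + 1 / y / 3 < 0" .
    have "\<bar>x / y\<bar> = \<bar>x\<bar> / y" using h(1) by simp
    also have "\<dots> < 1 / sqrt 3 / y"
      using h by (intro divide_strict_right_mono)
    also have "\<dots> = 1 / y / sqrt 3"
      by (simp add: mult.commute)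
    finally show "\<bar>x / y\<bar> < 1 / y / sqrt 3" .
  qed
qed

lemma sl2_cases:
  assumes "A \<in> sl2" obtains p q r where "A = mat2 p q r (- p)"
  using assms by (cases A rule: mat2_cases) (auto simp: sl2_def mat2_simps eq_neg_iff_add_eq_0 add.commute)

lemma sl2_diff_J: "A \<in> sl2 \<Longrightarrow> A - r *\<^sub>R J \<in> sl2"
  by (erule sl2_cases) (simp add: sl2_def J_def mat2_simps)

lemma bracket_minus_left: "bracket (- A) B = - bracket A B"
  by (cases A rule: mat2_cases, cases B rule: mat2_cases) (simp add: bracket_def mat2_simps)

lemma bracket_scaleR_left: "bracket (r *\<^sub>R A) B = r *\<^sub>R bracket A B"
  by (cases A rule: mat2_cases, cases B rule: mat2_cases)
    (simp add: bracket_def mat2_simps algebra_simps)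

text \<open>If \<open>tr_form R (Z v) / tr_form X (Z v)\<close> is a constant \<open>k\<close>, then \<open>R - k X\<close> is
  orthogonal to the three vertices of \<open>Z ` U_T\<close>, which form a basis of \<open>sl2\<close>;
  pairing \<open>R = k X\<close> with \<open>X\<close> gives \<open>k = 0\<close> because \<open>tr_form X X = - 2\<close>.\<close>

lemma constant_hamiltonian_imp_zero:
  assumes X: "X \<in> \<Phi> ` h_star" and R: "R \<in> sl2" "tr_form R X = 0"
    and const: "hamiltonian l X L R constant_on U_T"
  shows "R = 0"
proof -
  obtain p q r where X: "X = mat2 p q r (- p)" "- p * p - q * r = 1" "r > 0"
    "q + r / 3 < 0" "\<bar>p\<bar> < r / sqrt 3"
    using X by (rule \<Phi>_h_star_cases)
  obtain p' q' r' where R': "R = mat2 p' q' r' (- p')"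
    using R(1) by (rule sl2_cases)
  obtain c where c: "\<And>v. v \<in> U_T \<Longrightarrow> hamiltonian l X L R v = c"
    using const by (auto simp: constant_on_def)
  define k where "k = tr_form (L - (3/2 * l) *\<^sub>R J) X - c"
  have k: "tr_form R (Z v) = k * tr_form X (Z v)" if "v \<in> U_T" "tr_form X (Z v) \<noteq> 0" for v
    using c[OF that(1)] that(2) by (simp add: hamiltonian_def k_def field_simps)
  have s3: "sqrt 3 > 0" by simp
  have 0: "q' + r' / 3 = k * (q + r / 3)"
    using k[of "(1,0,0)"] X by (simp add: U_T_def Z_def tr_form_def R' mat2_simps)
  have tr1: "tr_form (mat2 p q r (- p)) (Z (0,1,0)) = 2 * (p / sqrt 3) - 2 * r / 3"
    and tr2: "tr_form (mat2 p q r (- p)) (Z (0,0,1)) = - 2 * (p / sqrt 3) - 2 * r / 3" for p q r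
    by (simp_all add: Z_def tr_form_def mat2_simps)
  \<comment> \<open>This makes the denominators at \<open>(0,1,0)\<close> and \<open>(0,0,1)\<close>
    nonzero.\<close>
  have less: "\<bar>p / sqrt 3\<bar> < r / 3"
    using divide_strict_right_mono[OF X(5) s3] by (simp add: divide_divide_eq_left)
  have 1: "2 * (p' / sqrt 3) - 2 * r' / 3 = k * (2 * (p / sqrt 3) - 2 * r / 3)"
  proof -
    have "(0,1,0) \<in> U_T" "2 * (p / sqrt 3) - 2 * r / 3 \<noteq> 0" using less by (simp add: U_T_def, linarith)
    then show ?thesis using k[of "(0,1,0)"] unfolding X(1) R' tr1 by blast
  qed
  have 2: "- 2 * (p' / sqrt 3) - 2 * r' / 3 = k * (- 2 * (p / sqrt 3) - 2 * r / 3)"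
  proof -
    have "(0,0,1) \<in> U_T" "- 2 * (p / sqrt 3) - 2 * r / 3 \<noteq> 0" using less by (simp add: U_T_def, linarith)
    then show ?thesis using k[of "(0,0,1)"] unfolding X(1) R' tr2 by blast
  qed
  have "r' = k * r" using 1 2 by (simp add: algebra_simps)
  moreover from this have "q' = k * q" using 0 by (simp add: algebra_simps)
  moreover have "p' = k * p" using 1 \<open>r' = k * r\<close> by (simp add: field_simps)
  ultimately have "R = k *\<^sub>R X" by (simp add: R' X mat2_simps)
  moreover have "tr_form X X = - 2" using X(2) by (simp add: X(1) tr_form_def mat2_simps)
  moreover have "tr_form (k *\<^sub>R X) X = k * tr_form X X"
    by (simp add: X(1) tr_form_def mat2_simps algebra_simps)
  ultimately show ?thesis using R(2) by auto
qed

text \<open>The centralizer of \<open>X\<close> in \<open>sl2\<close> is the line through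
  \<open>X\<close>, and \<open>X\<close> is not orthogonal to itself because
  \<open>tr_form X X = - 2\<close>.\<close>

lemma bracket_eq_0_imp_zero:
  assumes X: "X \<in> \<Phi> ` h_star" and A: "A \<in> sl2" "tr_form A X = 0" "bracket A X = 0"
  shows "A = 0"
proof -
  obtain p q r where X: "X = mat2 p q r (- p)" "- p * p - q * r = 1" "r > 0"
    using X by (rule \<Phi>_h_star_cases)
  obtain p' q' r' where A': "A = mat2 p' q' r' (- p')"
    using A(1) by (rule sl2_cases)
  have 1: "q' * r = r' * q" "p' * q = q' * p" "r' * p = p' * r" "2 * (p' * p) + q' * r + r' * q = 0"
    using A(2,3) by (simp_all add: bracket_def tr_form_def X(1) A' mat2_simps) algebra+
  \<comment> \<open>The factor is the determinant of \<open>X\<close>, which is 1. The commutation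
    relations reduce the product to a multiple of half the trace pairing, which vanishes.\<close>
  have "r' * (- p * p - q * r) = - ((r' * p) * p) - (r' * q) * r"
    by (simp add: algebra_simps)
  also have "\<dots> = - r * (p' * p + q' * r)"
    unfolding 1(3) 1(1)[symmetric] by (simp add: algebra_simps)
  also have "p' * p + q' * r = 0" using 1(1,4) by linarith
  also have "- r * 0 = 0" by simp
  finally have "r' * (- p * p - q * r) = 0" .
  then have "r' = 0" using X(2) by simp
  with 1 X show ?thesis by (auto simp: A' mat2_simps)
qed

text \<open>Commuting with \<open>J\<close> leaves only multiples of \<open>J\<close>; determinant 1
  leaves \<open>J\<close> and \<open>- J\<close>, and \<open>r > 0\<close> decides the sign.\<close>

lemma bracket_J_eq_0_imp_J:
  assumes X: "X \<in> \<Phi> ` h_star" and "bracket J X = 0"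
  shows "X = J"
proof -
  obtain p q r where X: "X = mat2 p q r (- p)" "- p * p - q * r = 1" "r > 0"
    using X by (rule \<Phi>_h_star_cases)
  have "p = 0" "q = - r"
    using assms(2) by (auto simp: bracket_def J_def X mat2_simps)
  then have "r\<^sup>2 = 1" using X by (simp add: power2_eq_square)
  then have "r = 1" using X(3) by (simp add: power2_eq_1_iff)
  with \<open>p = 0\<close> \<open>q = - r\<close> show ?thesis by (simp add: X J_def mat2_simps)
qed

lemma bracket_P_J_eq_0_imp_center:
  assumes u: "u \<in> U_T" and "bracket (P u J) J = 0"
  shows "u = (1/3, 1/3, 1/3)"
proof -
  obtain u0 u1 u2 where u': "u = (u0, u1, u2)" "u0 + u1 + u2 = 1"
    using u by (auto simp: U_T_def)
  \<comment> \<open>The denominator is constant on \<open>U_T\<close>, so the condition becomes that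
    \<open>Z u\<close> commutes with \<open>J\<close>: zero diagonal and opposite off-diagonal
    entries.\<close>
  have "tr_form (Z u) J = - 2 / 3 * (u0 + u1 + u2)"
    by (simp add: u'(1) Z_def J_def tr_form_def mat2_simps field_simps)
  then have "P u J = (- 3 / 2) *\<^sub>R Z u" by (simp add: P_def u')
  then have eq: "(u1 - u2) / sqrt 3 = 0" "(u0 - 2 * u1 - 2 * u2) / 3 + u0 = 0"
    using assms(2) by (auto simp: u'(1) bracket_def Z_def J_def mat2_simps field_simps)
  have "u1 = u2" using eq(1) by simp
  moreover have "2 * u0 = u1 + u2" using eq(2) by (simp add: field_simps)
  ultimately show ?thesis using u' by simp
qed

lemma J_eq_\<Phi>_i: "J = \<Phi> \<i>"
  by (simp add: J_def \<Phi>_def)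

lemma J_in_\<Phi>_h_star: "J \<in> \<Phi> ` h_star"
  unfolding J_eq_\<Phi>_i by (rule imageI) (simp add: h_star_def)

lemma bracket_P_center: "bracket (P (1/3, 1/3, 1/3) J) J = 0"
  by (simp add: P_def Z_def J_def tr_form_def bracket_def mat2_simps)

text \<open>The auxiliary curve \<open>h\<close> is \<open>g(t) exp(- J t)\<close>, whose derivative vanishes.\<close>

lemma circular_frame_unique:
  fixes g :: "real \<Rightarrow> real^2^2"
  assumes T: "is_interval T" "open T" "T \<noteq> {}" "T \<subseteq> I"
    and g: "loc_abs_continuous_on I g" and N: "negligible N"
    and g': "\<And>t. t \<in> T - N \<Longrightarrow> (g has_vector_derivative g t ** J) (at t)"
  obtains g0 where "\<And>t. t \<in> T \<Longrightarrow> g t = circular_frame g0 t"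
proof -
  define h where "h t = circular_frame (g t) (- t)" for t
  have contg: "continuous_on T g"
    by (rule loc_abs_continuous_on_imp_continuous_on[OF g T(2,4)])
  have h_const: "h s = h t" if st: "s \<in> T" "t \<in> T" "s \<le> t" for s t
  proof -
    have sub: "{s..t} \<subseteq> T"
      using mem_is_interval_1_I[OF T(1) st(1,2)] by auto
    \<comment> \<open>The equation holds only off \<open>N\<close> so far; continuity of its right
      side extends it to all points.\<close>
    have gd: "(g has_vector_derivative g x ** J) (at x within {s..t})" if x: "x \<in> {s..t}" for x
    proof (rule abs_continuous_on_has_vector_derivative[OF _ N _ _ x])
      show "abs_continuous_on {s..t} g"
        using g sub T(4) by (auto simp: loc_abs_continuous_on_def)
      show "(g has_vector_derivative g y ** J) (at y within {s..t})" if "y \<in> {s..t} - N" for y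
        using that sub by (intro has_vector_derivative_at_within[OF g']) blast
      show "continuous_on {s..t} (\<lambda>x. g x ** J)"
        by (intro bounded_linear.continuous_on[OF bounded_linear_mult_J]
            continuous_on_subset[OF contg sub])
    qed
    have hd: "(h has_vector_derivative 0) (at x within {s..t})" if x: "x \<in> {s..t}" for x
    proof -
      have gJ: "((\<lambda>t. g t ** J) has_vector_derivative g x ** J ** J) (at x within {s..t})"
        using bounded_linear.has_vector_derivative[OF bounded_linear_mult_J gd[OF x]] .
      \<comment> \<open>This curve is \<open>h\<close> written out; the terms cancel because
        \<open>J\<close> squares to -1.\<close>
      have "((\<lambda>t. cos t *\<^sub>R g t - sin t *\<^sub>R (g t ** J)) has_vector_derivative
          (cos x *\<^sub>R (g x ** J) + (- sin x) *\<^sub>R g x)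
          - (sin x *\<^sub>R (g x ** J ** J) + cos x *\<^sub>R (g x ** J))) (at x within {s..t})"
        by (intro has_vector_derivative_diff has_vector_derivative_scaleR gd[OF x] gJ
            has_field_derivative_at_within[OF DERIV_cos] has_field_derivative_at_within[OF DERIV_sin])
      then show ?thesis by (simp add: h_def[abs_def] circular_frame_eq)
    qed
    show ?thesis
      by (rule has_vector_derivative_zero_constant[OF convex_real_interval(5) hd]) (use st(3) in simp_all)
  qed
  obtain t0 where "t0 \<in> T" using T(3) by blast
  \<comment> \<open>The initial frame is the constant value of \<open>h\<close>; rotating it forward
    by \<open>t\<close> undoes the rotation in \<open>h t\<close>.\<close>
  have "g t = circular_frame (h t0) t" if "t \<in> T" for t
  proof -
    have "h t0 = h t"
      using h_const[OF that \<open>t0 \<in> T\<close>] h_const[OF \<open>t0 \<in> T\<close> that] linear[of t t0] by metis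
    then have "circular_frame (h t0) t = circular_frame (circular_frame (g t) (- t)) t"
      by (simp only: h_def)
    also have "\<dots> = g t" by (rule circular_frame_minus)
    finally show ?thesis ..
  qed
  then show thesis by (rule that)
qed

section \<open>From a control-independent Hamiltonian to the singular locus, and the
  converse\<close>

lemma singular_subarc_constant_hamiltonian:
  assumes "singular_subarc I T u g X \<Lambda>1 \<Lambda>R l"
    and const: "\<And>t. t \<in> T \<Longrightarrow> hamiltonian l (X t) (\<Lambda>1 t) (\<Lambda>R t) constant_on U_T"
  obtains N g0 where "negligible N" "g0 \<in> SL2" "l \<noteq> 0"
    "\<And>t. t \<in> T \<Longrightarrow> g t = circular_frame g0 t" "\<And>t. t \<in> T \<Longrightarrow> X t = J"
    "\<And>t. t \<in> T \<Longrightarrow> \<Lambda>1 t = (3/2 * l) *\<^sub>R J" "\<And>t. t \<in> T \<Longrightarrow> \<Lambda>R t = 0"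
    "\<And>t. t \<in> T - N \<Longrightarrow> u t = (1/3, 1/3, 1/3)"
proof -
  have ext: "pontryagin_extremal I u g X \<Lambda>1 \<Lambda>R l"
    and T: "is_interval T" "open T" "T \<noteq> {}" "T \<subseteq> I"
    using assms(1) unfolding singular_subarc_def by blast+
  have "is_interval I" using ext by (simp add: pontryagin_extremal_def)
  then have I: "I \<in> sets lebesgue" using real_interval_borel_measurable by auto
  have lac: "loc_abs_continuous_on I g" "loc_abs_continuous_on I X" "loc_abs_continuous_on I \<Lambda>1"
    and uU: "\<And>t. t \<in> T \<Longrightarrow> u t \<in> U_T" and gS: "\<And>t. t \<in> T \<Longrightarrow> g t \<in> SL2"
    and Xh: "\<And>t. t \<in> T \<Longrightarrow> X t \<in> \<Phi> ` h_star"
    and L1: "\<And>t. t \<in> T \<Longrightarrow> \<Lambda>1 t \<in> sl2"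
    and LR: "\<And>t. t \<in> T \<Longrightarrow> \<Lambda>R t \<in> sl2" "\<And>t. t \<in> T \<Longrightarrow> tr_form (\<Lambda>R t) (X t) = 0"
    and nz: "\<And>t. t \<in> T \<Longrightarrow> (l, \<Lambda>1 t, \<Lambda>R t) \<noteq> (0, 0, 0)"
    using ext T(4) unfolding pontryagin_extremal_def by blast+
  have LR0: "\<Lambda>R t = 0" if "t \<in> T" for t
    by (rule constant_hamiltonian_imp_zero[OF Xh LR const]) (fact that)+
  have cont: "continuous_on T X" "continuous_on T \<Lambda>1"
    using loc_abs_continuous_on_imp_continuous_on[OF _ T(2,4)] lac by blast+
  have AE: "AE t in lebesgue_on I.
        ((g has_vector_derivative g t ** X t) (at t within I) \<and>
        (X has_vector_derivative bracket (P (u t) (X t)) (X t)) (at t within I) \<and>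
        (\<Lambda>1 has_vector_derivative bracket (\<Lambda>1 t) (X t)) (at t within I) \<and>
        (\<Lambda>R has_vector_derivative
             bracket (P (u t) (X t)) (\<Lambda>R t)
             - tr_form (\<Lambda>R t) (P (u t) (X t)) *\<^sub>R bracket (P (u t) (X t)) (X t)
             + bracket (- \<Lambda>1 t + (3/2 * l) *\<^sub>R J) (X t)) (at t within I)) \<and>
        hamiltonian l (X t) (\<Lambda>1 t) (\<Lambda>R t) (u t) = 0"
    using ext unfolding pontryagin_extremal_def by (elim conjE) (simp add: AE_conj_iff)
  obtain N where N: "negligible N" and NI: "\<And>t. t \<in> I - N \<Longrightarrow>
        ((g has_vector_derivative g t ** X t) (at t within I) \<and>
        (X has_vector_derivative bracket (P (u t) (X t)) (X t)) (at t within I) \<and>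
        (\<Lambda>1 has_vector_derivative bracket (\<Lambda>1 t) (X t)) (at t within I) \<and>
        (\<Lambda>R has_vector_derivative
             bracket (P (u t) (X t)) (\<Lambda>R t)
             - tr_form (\<Lambda>R t) (P (u t) (X t)) *\<^sub>R bracket (P (u t) (X t)) (X t)
             + bracket (- \<Lambda>1 t + (3/2 * l) *\<^sub>R J) (X t)) (at t within I)) \<and>
        hamiltonian l (X t) (\<Lambda>1 t) (\<Lambda>R t) (u t) = 0"
    using AE_lebesgue_on_negligible[OF I AE] by blast
  have at_I: "at t within I = at t" if "t \<in> T" for t
    using that T(2,4) by (meson at_within_interior interior_maximal subsetD)
  have ode: "(g has_vector_derivative g t ** X t) (at t)"
      "(X has_vector_derivative bracket (P (u t) (X t)) (X t)) (at t)"
      "(\<Lambda>1 has_vector_derivative bracket (\<Lambda>1 t) (X t)) (at t)"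
      "(\<Lambda>R has_vector_derivative
             bracket (P (u t) (X t)) (\<Lambda>R t)
             - tr_form (\<Lambda>R t) (P (u t) (X t)) *\<^sub>R bracket (P (u t) (X t)) (X t)
             + bracket (- \<Lambda>1 t + (3/2 * l) *\<^sub>R J) (X t)) (at t)"
      "hamiltonian l (X t) (\<Lambda>1 t) (\<Lambda>R t) (u t) = 0"
    if "t \<in> T - N" for t
    using NI[of t] that T(4) by (auto simp: at_I)
  \<comment> \<open>Each curve once shown constant on \<open>T\<close> turns its differential
    equation into the algebraic condition that the right side is zero.\<close>
  have deriv_0: "D = 0" if "(f has_vector_derivative D) (at t)" "t \<in> T" "\<And>s. s \<in> T \<Longrightarrow> f s = c"
    for f :: "real \<Rightarrow> real^2^2" and D t c
  proof -
    have "(f has_vector_derivative 0) (at t)"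
      by (rule has_vector_derivative_transform_within_open[OF _ T(2)])
        (use that in \<open>auto intro: has_vector_derivative_const\<close>)
    with that(1) show ?thesis by (rule vector_derivative_unique_at)
  qed
  have L1J: "\<Lambda>1 t = (3/2 * l) *\<^sub>R J" if "t \<in> T" for t
  proof (rule continuous_on_eq_outside_negligible[OF T(2) cont(2) N _ that])
    fix t assume t: "t \<in> T - N"
    then have tT: "t \<in> T" by simp
    have "bracket (P (u t) (X t)) (\<Lambda>R t)
             - tr_form (\<Lambda>R t) (P (u t) (X t)) *\<^sub>R bracket (P (u t) (X t)) (X t)
             + bracket (- \<Lambda>1 t + (3/2 * l) *\<^sub>R J) (X t) = 0"
      using deriv_0[OF ode(4)[OF t] tT LR0] .
    \<comment> \<open>With \<open>\<Lambda>R t = 0\<close> only the last bracket of the costate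
      equation survives.\<close>
    then have br: "bracket (- \<Lambda>1 t + (3/2 * l) *\<^sub>R J) (X t) = 0"
      by (simp add: LR0[OF tT] bracket_def tr_form_def trace_0[unfolded mat_0])
    have H: "tr_form (\<Lambda>1 t - (3/2 * l) *\<^sub>R J) (X t) = 0"
      using ode(5)[OF t] by (simp add: hamiltonian_def LR0[OF tT] tr_form_def[of 0] trace_def)
    have "\<Lambda>1 t - (3/2 * l) *\<^sub>R J = 0"
    proof (rule bracket_eq_0_imp_zero[OF Xh[OF tT] _ H])
      show "\<Lambda>1 t - (3/2 * l) *\<^sub>R J \<in> sl2"
        using L1[OF tT] by (rule sl2_diff_J)
      show "bracket (\<Lambda>1 t - (3/2 * l) *\<^sub>R J) (X t) = 0"
        using br bracket_minus_left[of "\<Lambda>1 t - (3/2 * l) *\<^sub>R J" "X t"] by simp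
    qed
    then show "\<Lambda>1 t = (3/2 * l) *\<^sub>R J" by simp
  qed
  obtain t0 where t0: "t0 \<in> T" using T(3) by blast
  \<comment> \<open>If \<open>l\<close> were 0, all three multipliers would vanish at
    \<open>t0\<close>.\<close>
  have l: "l \<noteq> 0"
    using nz[OF t0] L1J[OF t0] LR0[OF t0] by auto
  have XJ: "X t = J" if "t \<in> T" for t
  proof (rule continuous_on_eq_outside_negligible[OF T(2) cont(1) N _ that])
    fix t assume t: "t \<in> T - N"
    then have tT: "t \<in> T" by simp
    have "bracket (\<Lambda>1 t) (X t) = 0"
      using deriv_0[OF ode(3)[OF t] tT L1J] .
    then have "bracket J (X t) = 0"
      using l by (simp add: L1J[OF tT] bracket_scaleR_left)
    with Xh[OF tT] show "X t = J" by (rule bracket_J_eq_0_imp_J)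
  qed
  have u: "u t = (1/3, 1/3, 1/3)" if "t \<in> T - N" for t
    using deriv_0[OF ode(2)[OF that] _ XJ] that uU bracket_P_J_eq_0_imp_center by (auto simp: XJ)
  obtain g0 where g0: "\<And>t. t \<in> T \<Longrightarrow> g t = circular_frame g0 t"
    using circular_frame_unique[OF T lac(1) N] ode(1) XJ by (metis Diff_iff)
  have "g0 \<in> SL2" using gS[OF t0] g0[OF t0] circular_frame_SL2 by simp
  with N l g0 XJ L1J LR0 u show thesis by (intro that) auto
qed

text \<open>Here \<open>\<Lambda>1\<close> cancels the cost term and \<open>\<Lambda>R\<close> is
  zero, so the Hamiltonian vanishes identically and every control maximizes it. All right sides
  except that of \<open>g\<close> are zero, and \<open>l < 0\<close> gives nontriviality.\<close>

lemma singular_subarc_circular_frame: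
  assumes "is_interval I" "is_interval T" "open T" "T \<noteq> {}" "T \<subseteq> I" "g0 \<in> SL2" "l < 0"
  shows "singular_subarc I T (\<lambda>t. (1/3, 1/3, 1/3)) (circular_frame g0) (\<lambda>t. J)
              (\<lambda>t. (3/2 * l) *\<^sub>R J) (\<lambda>t. 0) l"
proof -
  have tr0: "tr_form 0 A = 0" for A by (simp add: tr_form_def trace_def)
  have br0: "bracket 0 A = 0" "bracket A 0 = 0" for A by (simp_all add: bracket_def)
  define L where "L = (3/2 * l) *\<^sub>R J"
  \<comment> \<open>The last equation folds the coefficient back into \<open>L\<close> in the form
    that simplification gives it.\<close>
  have L: "L \<in> sl2" "bracket L J = 0" "(3 * l / 2) *\<^sub>R J = L"
    by (simp_all add: L_def sl2_def bracket_def J_def mat2_simps)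
  have lac: "loc_abs_continuous_on I (\<lambda>t. c)" for c :: "real^2^2"
    using lipschitz_on_imp_abs_continuous_on[OF lipschitz_on_constant]
    by (auto simp: loc_abs_continuous_on_def)
  have H: "hamiltonian l J L 0 = (\<lambda>v. 0)"
    by (simp add: hamiltonian_def tr0 L_def fun_eq_iff)
  have arg_max: "is_arg_max (\<lambda>v. 0::real) (\<lambda>v. v \<in> U_T) v \<longleftrightarrow> v \<in> U_T" for v
    by (auto simp: is_arg_max_def)
  \<comment> \<open>Two distinct controls, to refute uniqueness of the maximizer.\<close>
  have U: "(1/3, 1/3, 1/3) \<in> U_T" "(1, 0, 0) \<in> U_T" by (simp_all add: U_T_def)
  have "interior I \<noteq> {}"
    using assms(3-5) interior_maximal by blast
  moreover have "0 \<in> sl2" by (simp add: sl2_def mat2_simps)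
  ultimately have "pontryagin_extremal I (\<lambda>t. (1/3, 1/3, 1/3)) (circular_frame g0) (\<lambda>t. J)
              (\<lambda>t. L) (\<lambda>t. 0) l"
    using assms(1,6,7) U(1) J_in_\<Phi>_h_star
    by (simp add: pontryagin_extremal_def lac loc_abs_continuous_on_circular_frame circular_frame_SL2
        H arg_max tr0 br0 L bracket_P_center circular_frame_has_vector_derivative)
  moreover have "\<not> (\<exists>!v. is_arg_max (hamiltonian l J L 0) (\<lambda>v. v \<in> U_T) v)"
  proof
    assume "\<exists>!v. is_arg_max (hamiltonian l J L 0) (\<lambda>v. v \<in> U_T) v"
    then have "\<exists>!v. v \<in> U_T" unfolding H arg_max .
    then have "(1/3 :: real, 1/3 :: real, 1/3 :: real) = (1, 0, 0)" using U by blast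
    then show False by simp
  qed
  ultimately show ?thesis
    using assms unfolding L_def singular_subarc_def by blast
qed

theorem theorem8p2p6:
  shows "(\<forall>I T u g X \<Lambda>1 \<Lambda>R lcost.
            singular_subarc I T u g X \<Lambda>1 \<Lambda>R lcost \<and>
            (\<forall>t\<in>T. hamiltonian lcost (X t) (\<Lambda>1 t) (\<Lambda>R t) constant_on U_T)
            \<longrightarrow>
            (\<forall>t\<in>T. (g t, \<Lambda>1 t, X t, \<Lambda>R t) \<in> S_sing lcost) \<and>
            (\<exists>g0\<in>SL2. \<forall>t\<in>T.
               g t = circular_frame g0 t \<and> X t = J \<and>
               \<Lambda>1 t = (3/2 * lcost) *\<^sub>R J \<and> \<Lambda>R t = 0 \<and>
               (\<forall>j<6. multi_curve g j t = multi_curve (circular_frame g0) j t)) \<and>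
            (AE t in lebesgue_on T. u t = (1/3, 1/3, 1/3)))
       \<and>
         (\<forall>I T g0 lcost.
            is_interval I \<and> is_interval T \<and> open T \<and> T \<noteq> {} \<and> T \<subseteq> I \<and>
            g0 \<in> SL2 \<and> lcost < 0
            \<longrightarrow>
            singular_subarc I T (\<lambda>t. (1/3, 1/3, 1/3)) (circular_frame g0) (\<lambda>t. J)
              (\<lambda>t. (3/2 * lcost) *\<^sub>R J) (\<lambda>t. 0) lcost)"
proof (rule conjI; intro allI impI; (elim conjE)?)
  fix I T u g X \<Lambda>1 \<Lambda>R lcost
  assume sub: "singular_subarc I T u g X \<Lambda>1 \<Lambda>R lcost"
    and const: "\<forall>t\<in>T. hamiltonian lcost (X t) (\<Lambda>1 t) (\<Lambda>R t) constant_on U_T"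
  obtain N g0 where N: "negligible N" "g0 \<in> SL2" "lcost \<noteq> 0"
    and eq: "\<And>t. t \<in> T \<Longrightarrow> g t = circular_frame g0 t" "\<And>t. t \<in> T \<Longrightarrow> X t = J"
    "\<And>t. t \<in> T \<Longrightarrow> \<Lambda>1 t = (3/2 * lcost) *\<^sub>R J" "\<And>t. t \<in> T \<Longrightarrow> \<Lambda>R t = 0"
    and u: "\<And>t. t \<in> T - N \<Longrightarrow> u t = (1/3, 1/3, 1/3)"
    using singular_subarc_constant_hamiltonian[OF sub] const by blast
  have "open T" using sub by (simp add: singular_subarc_def)
  \<comment> \<open>At each time the witness in \<open>S_sing\<close> is the current frame
    \<open>g t\<close>, not the initial \<open>g0\<close>.\<close>
  have "\<forall>t\<in>T. (g t, \<Lambda>1 t, X t, \<Lambda>R t) \<in> S_sing lcost"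
    using N eq by (simp add: S_sing_def circular_frame_SL2)
  moreover have "\<forall>t\<in>T. g t = circular_frame g0 t \<and> X t = J \<and>
      \<Lambda>1 t = (3/2 * lcost) *\<^sub>R J \<and> \<Lambda>R t = 0 \<and>
      (\<forall>j<6. multi_curve g j t = multi_curve (circular_frame g0) j t)"
    using eq by (simp add: multi_curve_def)
  moreover have "AE t in lebesgue_on T. u t = (1/3, 1/3, 1/3)"
    using \<open>open T\<close> N(1) u by (intro AE_lebesgue_onI) auto
  ultimately show "(\<forall>t\<in>T. (g t, \<Lambda>1 t, X t, \<Lambda>R t) \<in> S_sing lcost) \<and>
            (\<exists>g0\<in>SL2. \<forall>t\<in>T.
               g t = circular_frame g0 t \<and> X t = J \<and>
               \<Lambda>1 t = (3/2 * lcost) *\<^sub>R J \<and> \<Lambda>R t = 0 \<and>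
               (\<forall>j<6. multi_curve g j t = multi_curve (circular_frame g0) j t)) \<and>
            (AE t in lebesgue_on T. u t = (1/3, 1/3, 1/3))"
    using N(2) by blast
qed (rule singular_subarc_circular_frame)

end
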